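(* For every $n\in\mathbb{N}_+=\{1,2,\dots\}$, the function $\Theta^n(x,\omega)=\mathrm{sinc}^n(x\cdot\omega)$, $(x,\omega)\in\mathbb{R}^d\times\mathbb{R}^d$, belongs to $W(\mathcal{F}L^1,L^\infty)(\mathbb{R}^{2d})$.
   Context: $\mathrm{sinc}(t)=\frac{\sin(\pi t)}{\pi t}$ for $t\ne0$, $\mathrm{sinc}(0)=1$; $x\cdot\omega$ is the scalar product in $\mathbb{R}^d$. Wiener amalgam spaces: for a fixed $g\in\mathcal{S}(\mathbb{R}^m)\setminus\{0\}$, let $V_gF(x,\omega)=\int_{\mathbb{R}^m}F(y)\overline{g(y-x)}e^{-2\pi i y\cdot\omega}\,dy$. $W(\mathcal{F}L^p,L^q)(\mathbb{R}^m)$ is the space of $F\in\mathcal{S}'(\mathbb{R}^m)$ with $\|F\|_{W(\mathcal{F}L^p,L^q)}=\big(\int(\int|V_gF(x,\omega)|^p\,d\omega)^{q/p}dx\big)^{1/q}<\infty$ (usual modification if $p=\infty$ or $q=\infty$); different $g$ give equivalent norms. In particular $F\in W(\mathcal{F}L^1,L^\infty)(\mathbb{R}^{m})$ means $\sup_{x\in\mathbb{R}^m}\int_{\mathbb{R}^m}|V_gF(x,\omega)|\,d\omega<\infty$. *)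

theory Defs
  imports "HOL-Analysis.Analysis"
begin

subsection \<open>Schwartz functions and tempered distributions\<close>

definition partial :: "'a::euclidean_space \<Rightarrow> ('a \<Rightarrow> complex) \<Rightarrow> 'a \<Rightarrow> complex" where
  "partial b f = (\<lambda>x. frechet_derivative f (at x) b)"

text \<open>The multi-index derivatives are the \<open>partials bs f\<close> with \<open>set bs \<subseteq> Basis\<close>; the
  order of a derivative is the length of the list.\<close>

definition partials :: "'a::euclidean_space list \<Rightarrow> ('a \<Rightarrow> complex) \<Rightarrow> 'a \<Rightarrow> complex" where
  "partials bs f = foldr partial bs f"

text \<open>Total differentiability of every iterated partial derivative amounts to
  \<open>C\<^sup>\<infinity>\<close>.\<close>

definition schwartz :: "('a::euclidean_space \<Rightarrow> complex) set" where
  "schwartz = {f. \<forall>bs. set bs \<subseteq> Basis \<longrightarrow>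
     partials bs f differentiable_on UNIV \<and>
     (\<forall>k::nat. bounded (range (\<lambda>x. (1 + norm x) ^ k *\<^sub>R partials bs f x)))}"

definition schwartz_seminorm :: "nat \<Rightarrow> ('a::euclidean_space \<Rightarrow> complex) \<Rightarrow> real" where
  "schwartz_seminorm N f =
     (\<Sum>bs | set bs \<subseteq> Basis \<and> length bs \<le> N. SUP x. (1 + norm x) ^ N * norm (partials bs f x))"

text \<open>Only the values on \<open>schwartz\<close> of a functional matter. Functionals are linear, not
  conjugate-linear.\<close>

definition tempered :: "(('a::euclidean_space \<Rightarrow> complex) \<Rightarrow> complex) set" where
  "tempered = {T.
     (\<forall>\<phi>\<in>schwartz. \<forall>\<psi>\<in>schwartz. T (\<lambda>x. \<phi> x + \<psi> x) = T \<phi> + T \<psi>) \<and>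
     (\<forall>c. \<forall>\<phi>\<in>schwartz. T (\<lambda>x. c * \<phi> x) = c * T \<phi>) \<and>
     (\<exists>C N. \<forall>\<phi>\<in>schwartz. norm (T \<phi>) \<le> C * schwartz_seminorm N \<phi>)}"

definition regular_distr :: "('a::euclidean_space \<Rightarrow> complex) \<Rightarrow> ('a \<Rightarrow> complex) \<Rightarrow> complex" where
  "regular_distr F \<phi> = (LINT y|lborel. F y * \<phi> y)"

subsection \<open>Short-time Fourier transform and Wiener amalgam spaces\<close>

definition stft ::
  "('a::euclidean_space \<Rightarrow> complex) \<Rightarrow> (('a \<Rightarrow> complex) \<Rightarrow> complex) \<Rightarrow> 'a \<Rightarrow> 'a \<Rightarrow> complex" where
  "stft g T x \<omega> = T (\<lambda>y. cnj (g (y - x)) * exp (- 2 * of_real pi * \<i> * of_real (y \<bullet> \<omega>)))"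

lemma stft_regular_distr:
  "stft g (regular_distr F) x \<omega> =
     (LINT y|lborel. F y * cnj (g (y - x)) * exp (- 2 * of_real pi * \<i> * of_real (y \<bullet> \<omega>)))"
  by (simp add: stft_def regular_distr_def mult.assoc)

definition epow :: "ennreal \<Rightarrow> real \<Rightarrow> ennreal" where
  "epow u r = (if u = \<infinity> then \<infinity> else ennreal (enn2real u powr r))"

text \<open>For \<open>1 \<le> p \<le> \<infinity>\<close>. At \<open>p = \<infinity>\<close> this is the supremum. It is applied below to
  lower semicontinuous functions only, for which it agrees with the essential supremum.\<close>

definition lp_norm :: "ennreal \<Rightarrow> ('a::euclidean_space \<Rightarrow> ennreal) \<Rightarrow> ennreal" where
  "lp_norm p f =
     (if p = \<infinity> then SUP x. f x
      else epow (\<integral>\<^sup>+ x. epow (f x) (enn2real p) \<partial>lborel) (1 / enn2real p))"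

definition amalgam_norm ::
  "('a::euclidean_space \<Rightarrow> complex) \<Rightarrow> ennreal \<Rightarrow> ennreal \<Rightarrow> (('a \<Rightarrow> complex) \<Rightarrow> complex) \<Rightarrow> ennreal"
  where
  "amalgam_norm g p q T = lp_norm q (\<lambda>x. lp_norm p (\<lambda>\<omega>. ennreal (norm (stft g T x \<omega>))))"

text \<open>The space \<open>W(\<F>L\<^sup>p, L\<^sup>q)\<close>, with the norm computed with the window \<open>g\<close>.\<close>

definition wiener_amalgam ::
  "('a::euclidean_space \<Rightarrow> complex) \<Rightarrow> ennreal \<Rightarrow> ennreal \<Rightarrow> (('a \<Rightarrow> complex) \<Rightarrow> complex) set" where
  "wiener_amalgam g p q = {T \<in> tempered. amalgam_norm g p q T < \<infinity>}"

text \<open>The functions whose distribution lies in \<open>W(\<F>L\<^sup>p, L\<^sup>q)\<close>. The integrability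
  condition is needed because the Bochner integral is \<open>0\<close> for non-integrable integrands.\<close>

definition wiener_amalgam_fun ::
  "('a::euclidean_space \<Rightarrow> complex) \<Rightarrow> ennreal \<Rightarrow> ennreal \<Rightarrow> ('a \<Rightarrow> complex) set" where
  "wiener_amalgam_fun g p q =
     {F. (\<forall>\<phi>\<in>schwartz. integrable lborel (\<lambda>y. F y * \<phi> y)) \<and>
         regular_distr F \<in> wiener_amalgam g p q}"

lemma epow_1 [simp]: "epow u 1 = u"
  by (cases u) (auto simp: epow_def)

lemma amalgam_norm_1_infinity:
  "amalgam_norm g 1 \<infinity> T = (SUP x. \<integral>\<^sup>+ \<omega>. ennreal (norm (stft g T x \<omega>)) \<partial>lborel)"
  by (simp add: amalgam_norm_def lp_norm_def)

subsection \<open>The functions \<open>\<Theta>\<^sup>n\<close>\<close>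

text \<open>The normalised cardinal sine.\<close>

definition nsinc :: "real \<Rightarrow> real" where
  "nsinc t = (if t = 0 then 1 else sin (pi * t) / (pi * t))"

definition Theta :: "nat \<Rightarrow> (real ^ 'd) \<times> (real ^ 'd) \<Rightarrow> complex" where
  "Theta n = (\<lambda>(x, \<omega>). of_real (nsinc (x \<bullet> \<omega>) ^ n))"

end

theory Submission
  imports Defs "HOL-Probability.Sinc_Integral"
begin

text \<open>
  Since \<open>sinc u\<close> is the average of \<open>exp (2 \<pi> i t u)\<close> over \<open>\<bar>t\<bar> \<le> 1/2\<close>, it suffices to bound,
  uniformly for \<open>t\<close> in a bounded interval, the amalgam norms of the chirps
  \<open>exp (2 \<pi> i t x \<bullet> \<omega>)\<close>; the powers are then handled by induction on \<open>n\<close> and the theorems of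
  Fubini and Tonelli. Translating the window by \<open>z = (x, \<omega>)\<close> changes a chirp only by a constant phase
  and a modulation with frequency \<open>t (\<omega>, x)\<close>. Hence the short-time Fourier transform of the chirp at
  \<open>z\<close> is, up to a phase, a translate of the Fourier transform of the chirp times the conjugate
  window, and its \<open>L\<^sup>1\<close> norm in the frequency does not depend on \<open>z\<close>. That norm is bounded locally
  uniformly in \<open>t\<close>: two integrations by parts in each coordinate give the integrable decay
  \<open>\<Prod>\<^sub>b 1 / (1 + \<zeta>\<^sub>b\<^sup>2)\<close>.
\<close>

section \<open>Integrals of rapidly decreasing functions\<close>

text \<open>The product form makes the integral factor over the coordinates, and its reciprocal is
  the polynomial weight that two integrations by parts in each coordinate produce.\<close>

definition decay_weight :: "'a::euclidean_space \<Rightarrow> real" where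
  "decay_weight x = (\<Prod>b\<in>Basis. 1 / (1 + (x \<bullet> b)\<^sup>2))"

lemma decay_weight_nonneg: "0 \<le> decay_weight x"
  unfolding decay_weight_def by (intro prod_nonneg) auto

lemma borel_measurable_decay_weight [measurable]: "decay_weight \<in> borel_measurable borel"
  unfolding decay_weight_def by measurable

lemma integrable_decay_weight: "integrable lborel (decay_weight :: 'a::euclidean_space \<Rightarrow> real)"
proof (rule integrableI_bounded)
  have "integrable lborel (\<lambda>x::real. 1 / (1 + x\<^sup>2))"
    using integrable_inverse_1_plus_square by (simp add: set_integrable_def inverse_eq_divide)
  then have fin: "(\<integral>\<^sup>+ x. ennreal (1 / (1 + x\<^sup>2)) \<partial>lborel) < \<infinity>"
    by (simp add: integrable_iff_bounded)
  have "(\<integral>\<^sup>+ x. ennreal (norm (decay_weight (x::'a))) \<partial>lborel) =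
      (\<integral>\<^sup>+ x. (\<Prod>b\<in>Basis. ennreal (1 / (1 + ((x::'a) \<bullet> b)\<^sup>2))) \<partial>lborel)"
    by (intro nn_integral_cong, subst prod_ennreal)
       (auto simp: decay_weight_nonneg, simp add: decay_weight_def)
  also have "\<dots> = (\<Prod>b\<in>(Basis::'a set). (\<integral>\<^sup>+ x. ennreal (1 / (1 + x\<^sup>2)) \<partial>lborel))"
    by (subst nn_integral_lborel_prod) auto
  also have "\<dots> < \<infinity>"
    using fin by (simp add: power_less_top_ennreal)
  finally show "(\<integral>\<^sup>+ x. ennreal (norm (decay_weight (x::'a))) \<partial>lborel) < \<infinity>" .
qed simp

text \<open>Each factor \<open>1 + (x \<bullet> b)\<^sup>2\<close> is at most
  \<open>(1 + norm x)\<^sup>2\<close>, and there are \<open>DIM('a)\<close> of them. This is the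
  origin of the exponent \<open>2 * DIM('a)\<close> in all later decay bounds.\<close>

lemma norm_le_decay_weight:
  fixes x :: "'a::euclidean_space"
  assumes "(1 + norm x) ^ (2 * DIM('a)) * norm (z::'b::real_normed_vector) \<le> C"
  shows "norm z \<le> C * decay_weight x"
proof -
  let ?P = "\<Prod>b\<in>(Basis::'a set). 1 + (x \<bullet> b)\<^sup>2"
  have "?P \<le> ((1 + norm x)\<^sup>2) ^ DIM('a)"
  proof (rule prod_le_power)
    fix b :: 'a assume "b \<in> Basis"
    then have "(x \<bullet> b)\<^sup>2 \<le> (norm x)\<^sup>2"
      by (metis Basis_le_norm abs_le_square_iff abs_norm_cancel)
    then show "0 \<le> 1 + (x \<bullet> b)\<^sup>2 \<and> 1 + (x \<bullet> b)\<^sup>2 \<le> (1 + norm x)\<^sup>2"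
      by (auto simp: power2_sum add_increasing2)
  qed auto
  then have "?P * norm z \<le> (1 + norm x) ^ (2 * DIM('a)) * norm z"
    by (intro mult_right_mono) (auto simp: power_mult)
  with assms have "?P * norm z \<le> C" by linarith
  moreover have "0 < ?P" by (intro prod_pos) (auto simp: add_pos_nonneg)
  ultimately show ?thesis
    by (simp add: decay_weight_def prod_dividef field_simps)
qed

text \<open>Domination by \<open>C * decay_weight\<close>. The explicit constant serves twice: for
  bounds uniform in the chirp parameter and for the continuity of regular distributions.\<close>

lemma
  fixes f :: "'a::euclidean_space \<Rightarrow> complex"
  assumes [measurable]: "f \<in> borel_measurable borel"
    and bound: "\<And>x. (1 + norm x) ^ (2 * DIM('a)) * norm (f x) \<le> C"
  shows integrable_decay: "integrable lborel f"
    and norm_integral_decay: "norm (LINT x|lborel. f x) \<le> C * (LINT x|lborel. decay_weight (x::'a))"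
proof -
  note le = norm_le_decay_weight[OF bound]
  have W: "integrable lborel (\<lambda>x::'a. C * decay_weight x)"
    by (intro integrable_mult_right integrable_decay_weight)
  show "integrable lborel f"
    by (rule Bochner_Integration.integrable_bound[OF W])
       (auto intro!: AE_I2 order_trans[OF le])
  show "norm (LINT x|lborel. f x) \<le> C * (LINT x|lborel. decay_weight (x::'a))"
    using Bochner_Integration.integral_norm_bound_integral[OF \<open>integrable lborel f\<close> W] le by simp
qed

section \<open>Translation invariance of the Lebesgue integral\<close>

lemma integral_lborel_translate:
  fixes f :: "'a::euclidean_space \<Rightarrow> complex"
  assumes [measurable]: "f \<in> borel_measurable borel"
  shows "(LINT x|lborel. f (c + x)) = (LINT x|lborel. f x)"
proof -
  have "(LINT x|distr lborel borel ((+) c). f x) = (LINT x|lborel. f (c + x))"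
    by (rule integral_distr) auto
  then show ?thesis by (simp add: lborel_distr_plus)
qed

lemma integrable_lborel_translate:
  fixes f :: "'a::euclidean_space \<Rightarrow> complex"
  assumes "f \<in> borel_measurable borel" "integrable lborel f"
  shows "integrable lborel (\<lambda>x. f (c + x))"
  using assms by (intro integrable_distr[where M'=borel and T="(+) c"]) (auto simp: lborel_distr_plus)

lemma nn_integral_lborel_translate:
  fixes f :: "'a::euclidean_space \<Rightarrow> ennreal"
  assumes [measurable]: "f \<in> borel_measurable borel"
  shows "(\<integral>\<^sup>+ x. f (c + x) \<partial>lborel) = (\<integral>\<^sup>+ x. f x \<partial>lborel)"
proof -
  have "(\<integral>\<^sup>+ x. f x \<partial>distr lborel borel ((+) c)) = (\<integral>\<^sup>+ x. f (c + x) \<partial>lborel)"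
    by (rule nn_integral_distr) auto
  then show ?thesis by (simp add: lborel_distr_plus)
qed

section \<open>Directional derivatives and the vanishing of their integrals\<close>

definition has_dir_deriv ::
  "('a::euclidean_space \<Rightarrow> complex) \<Rightarrow> 'a \<Rightarrow> ('a \<Rightarrow> complex) \<Rightarrow> bool" where
  "has_dir_deriv f b f' \<longleftrightarrow>
     (\<forall>x. ((\<lambda>r. f (x + r *\<^sub>R b)) has_vector_derivative f' x) (at 0))"

text \<open>The definition speaks of the parameter 0 only; taking \<open>x + r *\<^sub>R b\<close>
  as base point gives the derivative all along the line, as the mean value inequality
  requires.\<close>

lemma has_dir_derivD:
  assumes "has_dir_deriv f b f'"
  shows "((\<lambda>r. f (x + r *\<^sub>R b)) has_vector_derivative f' (x + r *\<^sub>R b)) (at r)"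
proof -
  have "((\<lambda>s. f ((x + r *\<^sub>R b) + s *\<^sub>R b)) has_vector_derivative f' (x + r *\<^sub>R b)) (at (r - r))"
    using assms by (simp add: has_dir_deriv_def)
  moreover have "((\<lambda>s. s - r) has_vector_derivative 1) (at r)"
    by (auto intro!: derivative_eq_intros)
  ultimately show ?thesis
    using vector_diff_chain_at[of "\<lambda>s. s - r" 1 r "\<lambda>s. f ((x + r *\<^sub>R b) + s *\<^sub>R b)"]
    by (simp add: o_def algebra_simps)
qed

text \<open>The difference quotients have integral \<open>0\<close> by translation invariance, and they converge
  dominatedly.\<close>

lemma integral_dir_deriv_eq_0:
  fixes f f' :: "'a::euclidean_space \<Rightarrow> complex"
  assumes b: "norm b \<le> 1"
    and [measurable]: "f \<in> borel_measurable borel" "f' \<in> borel_measurable borel"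
    and der: "has_dir_deriv f b f'"
    and bound: "\<And>x. (1 + norm x) ^ (2 * DIM('a)) * norm (f x) \<le> C"
    and bound': "\<And>x. (1 + norm x) ^ (2 * DIM('a)) * norm (f' x) \<le> C"
  shows "(LINT x|lborel. f' x) = 0"
proof -
  define k where "k = 2 * DIM('a)"
  define D where "D n x = real (Suc n) *\<^sub>R (f (x + (1 / Suc n) *\<^sub>R b) - f x)" for n x
  have int: "integrable lborel f" by (rule integrable_decay[OF _ bound]) simp
  \<comment> \<open>A shift by at most 1 gives \<open>1 + norm x\<close> at most twice its value at
    the shifted point. So \<open>f'\<close> is bounded on the whole segment by a weight at
    \<open>x\<close>, at the price of the factor \<open>2 ^ k\<close>.\<close>
  have shift: "(1 + norm x) ^ k * norm (f' (x + r *\<^sub>R b)) \<le> 2 ^ k * C"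
    if "r \<in> {0..1}" for r x
  proof -
    have "norm (r *\<^sub>R b) \<le> 1"
      using that b by (simp add: mult_le_one)
    moreover have "norm x \<le> norm (x + r *\<^sub>R b) + norm (r *\<^sub>R b)"
      by (metis norm_triangle_ineq4 add_diff_cancel_right')
    ultimately have "1 + norm x \<le> 2 * (1 + norm (x + r *\<^sub>R b))"
      using norm_ge_zero[of "x + r *\<^sub>R b"] by (smt (verit))
    then have "(1 + norm x) ^ k \<le> (2 * (1 + norm (x + r *\<^sub>R b))) ^ k"
      by (intro power_mono) auto
    then have "(1 + norm x) ^ k * norm (f' (x + r *\<^sub>R b)) \<le>
        (2 * (1 + norm (x + r *\<^sub>R b))) ^ k * norm (f' (x + r *\<^sub>R b))"
      by (intro mult_right_mono) auto
    also have "\<dots> = 2 ^ k * ((1 + norm (x + r *\<^sub>R b)) ^ k * norm (f' (x + r *\<^sub>R b)))"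
      by (simp only: power_mult_distrib mult.assoc)
    also have "\<dots> \<le> 2 ^ k * C"
      using bound' by (intro mult_left_mono) (auto simp: k_def)
    finally show ?thesis .
  qed
  have D_le: "norm (D n x) \<le> (2 ^ k * C) * decay_weight x" for n x
  proof -
    let ?h = "1 / real (Suc n)"
    \<comment> \<open>The mean value inequality on the segment turns the bound on \<open>f'\<close>
      into a majorant of the difference quotients that is independent of \<open>n\<close>.\<close>
    have "norm (f (x + ?h *\<^sub>R b) - f (x + 0 *\<^sub>R b)) \<le> ((2 ^ k * C) * decay_weight x) * norm (?h - 0)"
    proof (rule differentiable_bound[of "{0..?h}" "\<lambda>r. f (x + r *\<^sub>R b)"
          "\<lambda>r s. s *\<^sub>R f' (x + r *\<^sub>R b)"])
      fix r assume r: "r \<in> {0..?h}"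
      show "((\<lambda>r. f (x + r *\<^sub>R b)) has_derivative (\<lambda>s. s *\<^sub>R f' (x + r *\<^sub>R b))) (at r within {0..?h})"
        using has_dir_derivD[OF der] by (auto simp: has_vector_derivative_def intro: has_derivative_at_withinI)
      have "?h \<le> 1" by simp
      with r have "r \<in> {0..1}" unfolding atLeastAtMost_iff by (meson order_trans)
      then have "norm (f' (x + r *\<^sub>R b)) \<le> (2 ^ k * C) * decay_weight x"
        using shift by (intro norm_le_decay_weight) (simp add: k_def)
      moreover have "onorm (\<lambda>s. s *\<^sub>R f' (x + r *\<^sub>R b)) \<le> norm (f' (x + r *\<^sub>R b))"
        by (rule onorm_le) simp
      ultimately show "onorm (\<lambda>s. s *\<^sub>R f' (x + r *\<^sub>R b)) \<le> (2 ^ k * C) * decay_weight x"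
        by (rule order_trans[rotated])
    qed auto
    then have "real (Suc n) * norm (f (x + ?h *\<^sub>R b) - f x) \<le>
        real (Suc n) * (((2 ^ k * C) * decay_weight x) * ?h)"
      by (intro mult_left_mono) auto
    then show ?thesis
      unfolding D_def norm_scaleR by (simp add: field_simps del: of_nat_Suc)
  qed
  have "(\<lambda>n. LINT x|lborel. D n x) \<longlonglongrightarrow> (LINT x|lborel. f' x)"
  proof (rule integral_dominated_convergence[where w="\<lambda>x. (2 ^ k * C) * decay_weight x"])
    show "integrable lborel (\<lambda>x::'a. (2 ^ k * C) * decay_weight x)"
      by (intro integrable_mult_right integrable_decay_weight)
    have "(\<lambda>n. D n x) \<longlonglongrightarrow> f' x" for x
    proof -
      have "((\<lambda>r. (1 / r) *\<^sub>R (f (x + r *\<^sub>R b) - f x)) \<longlongrightarrow> f' x) (at 0)"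
      proof (rule LIM_zero_cancel, rule tendsto_norm_zero_cancel)
        have "((\<lambda>r. norm (f (x + r *\<^sub>R b) - f x - r *\<^sub>R f' x) / norm r) \<longlongrightarrow> 0) (at 0)"
          using der by (auto simp: has_dir_deriv_def has_vector_derivative_def has_derivative_iff_norm)
        moreover have "\<forall>\<^sub>F r in at (0::real). norm (f (x + r *\<^sub>R b) - f x - r *\<^sub>R f' x) / norm r =
            norm ((1 / r) *\<^sub>R (f (x + r *\<^sub>R b) - f x) - f' x)"
        proof (rule eventually_at_filter[THEN iffD2], intro always_eventually allI impI)
          fix r :: real assume "r \<noteq> 0"
          then have "(1 / r) *\<^sub>R (f (x + r *\<^sub>R b) - f x) - f' x =
              (1 / r) *\<^sub>R (f (x + r *\<^sub>R b) - f x - r *\<^sub>R f' x)"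
            by (simp add: scaleR_diff_right)
          then show "norm (f (x + r *\<^sub>R b) - f x - r *\<^sub>R f' x) / norm r =
              norm ((1 / r) *\<^sub>R (f (x + r *\<^sub>R b) - f x) - f' x)"
            by simp
        qed
        ultimately show "((\<lambda>r. norm ((1 / r) *\<^sub>R (f (x + r *\<^sub>R b) - f x) - f' x)) \<longlongrightarrow> 0) (at 0)"
          by (rule Lim_transform_eventually)
      qed
      then have "(\<lambda>n. (1 / (1 / Suc n)) *\<^sub>R (f (x + (1 / Suc n) *\<^sub>R b) - f x)) \<longlonglongrightarrow> f' x"
        by (rule filterlim_compose)
           (auto simp: filterlim_at intro!: LIMSEQ_Suc[OF lim_1_over_n, simplified])
      then show ?thesis by (simp add: D_def)
    qed
    then show "AE x in lborel. (\<lambda>n. D n x) \<longlonglongrightarrow> f' x" by simp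
    show "AE x in lborel. norm (D n x) \<le> 2 ^ k * C * decay_weight x" for n
      using D_le by simp
  qed (simp_all add: D_def)
  moreover have "(LINT x|lborel. D n x) = 0" for n
  proof -
    have "(LINT x|lborel. f (x + (1 / Suc n) *\<^sub>R b)) = (LINT x|lborel. f x)"
      using integral_lborel_translate[of f "(1 / Suc n) *\<^sub>R b"] by (simp add: add.commute)
    moreover have "integrable lborel (\<lambda>x. f (x + (1 / Suc n) *\<^sub>R b))"
      using integrable_lborel_translate[OF _ int, of "(1 / Suc n) *\<^sub>R b"] by (simp add: add.commute)
    ultimately show ?thesis using int by (simp add: D_def)
  qed
  ultimately show ?thesis
    by (simp add: LIMSEQ_const_iff)
qed

lemma has_dir_deriv_add:
  "has_dir_deriv f b f' \<Longrightarrow> has_dir_deriv g b g' \<Longrightarrow>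
    has_dir_deriv (\<lambda>x. f x + g x) b (\<lambda>x. f' x + g' x)"
  by (auto simp: has_dir_deriv_def intro!: derivative_eq_intros)

lemma has_dir_deriv_mult:
  assumes "has_dir_deriv f b f'" "has_dir_deriv g b g'"
  shows "has_dir_deriv (\<lambda>x. f x * g x) b (\<lambda>x. f x * g' x + f' x * g x)"
  unfolding has_dir_deriv_def
proof
  fix x
  from has_vector_derivative_mult[of "\<lambda>r. f (x + r *\<^sub>R b)" "f' x" 0 UNIV "\<lambda>r. g (x + r *\<^sub>R b)" "g' x"] assms
  show "((\<lambda>r. f (x + r *\<^sub>R b) * g (x + r *\<^sub>R b)) has_vector_derivative f x * g' x + f' x * g x) (at 0)"
    by (simp add: has_dir_deriv_def)
qed

lemma has_dir_deriv_cmult: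
  assumes "has_dir_deriv f b f'"
  shows "has_dir_deriv (\<lambda>x. a * f x) b (\<lambda>x. a * f' x)"
  using has_dir_deriv_mult[OF _ assms, of "\<lambda>_. a" "\<lambda>_. 0"]
  by (simp add: has_dir_deriv_def)

lemma has_dir_deriv_inner:
  "has_dir_deriv (\<lambda>x. complex_of_real (x \<bullet> c)) b (\<lambda>_. complex_of_real (b \<bullet> c))"
  unfolding has_dir_deriv_def
  by (auto simp: inner_left_distrib intro!: derivative_eq_intros has_vector_derivative_of_real)

section \<open>Chirps and their Fourier transforms\<close>

definition chirp :: "real \<Rightarrow> 'v::euclidean_space \<times> 'v \<Rightarrow> complex" where
  "chirp t y = exp (\<i> * of_real (2 * pi * t * (fst y \<bullet> snd y)))"

lemma norm_chirp [simp]: "norm (chirp t y) = 1"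
  by (simp add: chirp_def)

lemma chirp_add: "chirp (s + t) y = chirp s y * chirp t y"
  by (simp add: chirp_def exp_add [symmetric] algebra_simps)

lemma continuous_on_chirp: "continuous_on UNIV (chirp t)"
  unfolding chirp_def by (intro continuous_intros)

text \<open>The gradient of the phase \<open>fst y \<bullet> snd y\<close> is
  \<open>prod.swap y\<close>, whence \<open>y \<bullet> prod.swap b\<close>. The nesting of the
  factors follows the rules \<open>scale\<close>, \<open>parameter\<close> and \<open>linear\<close>
  of \<open>chirped\<close> below.\<close>

lemma has_dir_deriv_chirp:
  "has_dir_deriv (chirp t) b
    (\<lambda>y. 2 * of_real pi * \<i> * (of_real t * (of_real (y \<bullet> prod.swap b) * chirp t y)))"
  unfolding has_dir_deriv_def
proof
  fix y :: "'a \<times> 'a"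
  have "((\<lambda>r. \<i> * of_real (2 * pi * t * (fst (y + r *\<^sub>R b) \<bullet> snd (y + r *\<^sub>R b))))
      has_vector_derivative \<i> * of_real (2 * pi * t * (y \<bullet> prod.swap b))) (at 0)"
    by (auto simp: inner_left_distrib inner_right_distrib inner_prod_def inner_commute
        has_real_derivative_iff_has_vector_derivative[symmetric]
        intro!: derivative_eq_intros has_vector_derivative_of_real)
  from field_vector_diff_chain_at[OF this DERIV_exp]
  show "((\<lambda>r. chirp t (y + r *\<^sub>R b)) has_vector_derivative
      2 * of_real pi * \<i> * (of_real t * (of_real (y \<bullet> prod.swap b) * chirp t y))) (at 0)"
    by (simp add: chirp_def o_def algebra_simps)
qed

text \<open>The kernel is written exactly as in \<open>stft\<close>, so that folding this definition
  exposes the Fourier integral there.\<close>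

definition wave :: "'a::euclidean_space \<Rightarrow> 'a \<Rightarrow> complex" where
  "wave \<zeta> y = exp (- 2 * of_real pi * \<i> * of_real (y \<bullet> \<zeta>))"

lemma norm_wave [simp]: "norm (wave \<zeta> y) = 1"
  by (simp add: wave_def)

lemma continuous_on_wave: "continuous_on UNIV (wave \<zeta>)"
  unfolding wave_def by (intro continuous_intros)

lemma has_dir_deriv_wave:
  "has_dir_deriv (wave \<zeta>) b (\<lambda>y. - 2 * of_real pi * \<i> * of_real (b \<bullet> \<zeta>) * wave \<zeta> y)"
  unfolding has_dir_deriv_def
proof
  fix y :: 'a
  have "((\<lambda>r. - 2 * of_real pi * \<i> * of_real ((y + r *\<^sub>R b) \<bullet> \<zeta>))
      has_vector_derivative - 2 * of_real pi * \<i> * of_real (b \<bullet> \<zeta>)) (at 0)"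
    by (auto simp: inner_left_distrib
        has_real_derivative_iff_has_vector_derivative[symmetric]
        intro!: derivative_eq_intros has_vector_derivative_of_real)
  from field_vector_diff_chain_at[OF this DERIV_exp]
  show "((\<lambda>r. wave \<zeta> (y + r *\<^sub>R b)) has_vector_derivative
      - 2 * of_real pi * \<i> * of_real (b \<bullet> \<zeta>) * wave \<zeta> y) (at 0)"
    by (simp add: wave_def o_def algebra_simps)
qed

definition fourier :: "('a::euclidean_space \<Rightarrow> complex) \<Rightarrow> 'a \<Rightarrow> complex" where
  "fourier f \<zeta> = (LINT y|lborel. f y * wave \<zeta> y)"

text \<open>Integration by parts: the derivative of \<open>f\<close> times the plane wave along
  \<open>b\<close> has integral 0, and its two terms are the two sides of the identity.\<close>

lemma fourier_dir_deriv:
  fixes f f' :: "'a::euclidean_space \<Rightarrow> complex"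
  assumes b: "norm b \<le> 1"
    and cont: "continuous_on UNIV f" "continuous_on UNIV f'"
    and der: "has_dir_deriv f b f'"
    and bound: "\<And>x. (1 + norm x) ^ (2 * DIM('a)) * norm (f x) \<le> C"
    and bound': "\<And>x. (1 + norm x) ^ (2 * DIM('a)) * norm (f' x) \<le> C"
  shows "fourier f' \<zeta> = 2 * of_real pi * \<i> * of_real (b \<bullet> \<zeta>) * fourier f \<zeta>"
proof -
  note [measurable] = cont[THEN borel_measurable_continuous_onI]
    borel_measurable_continuous_onI[OF continuous_on_wave]
  define a where "a = - 2 * complex_of_real pi * \<i> * of_real (b \<bullet> \<zeta>)"
  have C: "0 \<le> C" using bound[of 0] by (simp add: order_trans[OF norm_ge_zero])
  have int: "integrable lborel (\<lambda>y. f y * wave \<zeta> y)" "integrable lborel (\<lambda>y. f' y * wave \<zeta> y)"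
    using bound bound' by (auto intro!: integrable_decay[where C=C] simp: norm_mult)
  have "(LINT y|lborel. f y * (a * wave \<zeta> y) + f' y * wave \<zeta> y) = 0"
  \<comment> \<open>One constant must bound both the product and its derivative; the latter
    contributes \<open>C * norm a\<close> from the wave and \<open>C\<close> from
    \<open>f'\<close>.\<close>
  proof (rule integral_dir_deriv_eq_0[OF b, where C="C * norm a + C"])
    show "has_dir_deriv (\<lambda>y. f y * wave \<zeta> y) b (\<lambda>y. f y * (a * wave \<zeta> y) + f' y * wave \<zeta> y)"
      unfolding a_def by (rule has_dir_deriv_mult[OF der has_dir_deriv_wave])
    fix x
    show "(1 + norm x) ^ (2 * DIM('a)) * norm (f x * wave \<zeta> x) \<le> C * norm a + C"
      using bound[of x] C by (simp add: norm_mult add_increasing)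
    have "norm (f x * (a * wave \<zeta> x) + f' x * wave \<zeta> x) \<le> norm (f x) * norm a + norm (f' x)"
      using norm_triangle_ineq[of "f x * (a * wave \<zeta> x)" "f' x * wave \<zeta> x"] by (simp add: norm_mult)
    then have "(1 + norm x) ^ (2 * DIM('a)) * norm (f x * (a * wave \<zeta> x) + f' x * wave \<zeta> x) \<le>
        (1 + norm x) ^ (2 * DIM('a)) * (norm (f x) * norm a + norm (f' x))"
      by (intro mult_left_mono) auto
    also have "\<dots> = ((1 + norm x) ^ (2 * DIM('a)) * norm (f x)) * norm a +
        (1 + norm x) ^ (2 * DIM('a)) * norm (f' x)"
      by (simp add: algebra_simps)
    also have "\<dots> \<le> C * norm a + C"
      using bound[of x] bound'[of x] by (intro add_mono mult_right_mono) auto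
    finally show "(1 + norm x) ^ (2 * DIM('a)) * norm (f x * (a * wave \<zeta> x) + f' x * wave \<zeta> x) \<le>
        C * norm a + C" .
  qed measurable
  also have "(\<lambda>y. f y * (a * wave \<zeta> y) + f' y * wave \<zeta> y) =
      (\<lambda>y. a * (f y * wave \<zeta> y) + f' y * wave \<zeta> y)"
    by (simp add: fun_eq_iff)
  finally have "a * fourier f \<zeta> + fourier f' \<zeta> = 0"
    using int by (simp add: fourier_def)
  then show ?thesis by (simp add: a_def add_eq_0_iff)
qed

text \<open>The functions, depending on a parameter \<open>t\<close>, that arise from \<open>chirp t * cnj g\<close> by repeated
  differentiation: the rules are those needed for closure under directional derivatives with
  bounds that are uniform for bounded \<open>t\<close>.\<close>

inductive_set chirped :: "('v::euclidean_space \<times> 'v \<Rightarrow> complex) \<Rightarrow> (real \<Rightarrow> 'v \<times> 'v \<Rightarrow> complex) set"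
  for g where
  base: "set bs \<subseteq> Basis \<Longrightarrow> (\<lambda>t y. chirp t y * cnj (partials bs g y)) \<in> chirped g"
| linear: "h \<in> chirped g \<Longrightarrow> (\<lambda>t y. of_real (y \<bullet> c) * h t y) \<in> chirped g"
| parameter: "h \<in> chirped g \<Longrightarrow> (\<lambda>t y. of_real t * h t y) \<in> chirped g"
| scale: "h \<in> chirped g \<Longrightarrow> (\<lambda>t y. a * h t y) \<in> chirped g"
| add: "h \<in> chirped g \<Longrightarrow> h' \<in> chirped g \<Longrightarrow> (\<lambda>t y. h t y + h' t y) \<in> chirped g"

section \<open>Derivatives, continuity and uniform decay of windowed chirps\<close>

lemma schwartz_bounded:
  assumes "f \<in> schwartz" "set bs \<subseteq> Basis"
  obtains C where "\<And>x. (1 + norm x) ^ k * norm (partials bs f x) \<le> C"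
proof -
  have "bounded (range (\<lambda>x. (1 + norm x) ^ k *\<^sub>R partials bs f x))"
    using assms by (auto simp: schwartz_def)
  then obtain C where "\<And>x. norm ((1 + norm x) ^ k *\<^sub>R partials bs f x) \<le> C"
    by (auto simp: bounded_iff)
  then show thesis
    by (intro that[of C]) (simp add: norm_power)
qed

lemma schwartz_differentiable:
  "f \<in> schwartz \<Longrightarrow> set bs \<subseteq> Basis \<Longrightarrow> partials bs f differentiable_on UNIV"
  by (auto simp: schwartz_def)

lemma has_dir_deriv_cnj_partials:
  assumes "f \<in> schwartz" "set bs \<subseteq> Basis"
  shows "has_dir_deriv (\<lambda>y. cnj (partials bs f y)) b (\<lambda>y. cnj (partials (b # bs) f y))"
  unfolding has_dir_deriv_def
proof
  fix x
  have "(partials bs f has_derivative frechet_derivative (partials bs f) (at x)) (at x)"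
    using schwartz_differentiable[OF assms]
    by (simp add: differentiable_on_def frechet_derivative_works)
  then have der: "(partials bs f has_derivative frechet_derivative (partials bs f) (at x)) (at (x + 0 *\<^sub>R b))"
    by simp
  have "((\<lambda>r::real. x + r *\<^sub>R b) has_derivative (\<lambda>r. r *\<^sub>R b)) (at 0)"
    by (auto intro!: derivative_eq_intros)
  from has_derivative_compose[OF this der]
  have "((\<lambda>r. partials bs f (x + r *\<^sub>R b)) has_vector_derivative
      frechet_derivative (partials bs f) (at x) b) (at 0)"
    using linear_frechet_derivative[of "partials bs f" "at x"] schwartz_differentiable[OF assms]
    by (simp add: has_vector_derivative_def linear_cmul differentiable_on_def)
  then show "((\<lambda>r. cnj (partials bs f (x + r *\<^sub>R b))) has_vector_derivative
      cnj (partials (b # bs) f x)) (at 0)"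
    by (simp add: has_vector_derivative_cnj partials_def partial_def)
qed

text \<open>A single family \<open>h'\<close> serves all \<open>t\<close>, which keeps later bounds
  uniform. Only the base case creates new factors: the window gains a partial derivative, the chirp
  a multiple of \<open>t\<close> and of a linear form.\<close>

lemma chirped_dir_deriv:
  assumes "g \<in> schwartz" "h \<in> chirped g" "b \<in> Basis"
  shows "\<exists>h'\<in>chirped g. \<forall>t. has_dir_deriv (h t) b (h' t)"
  using assms(2)
proof induction
  case (base bs)
  let ?h = "\<lambda>t y. chirp t y * cnj (partials bs g y)"
  have h: "?h \<in> chirped g" using base by (rule chirped.base)
  let ?h' = "\<lambda>t y. chirp t y * cnj (partials (b # bs) g y) +
      2 * of_real pi * \<i> * (of_real t * (of_real (y \<bullet> prod.swap b) * ?h t y))"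
  have "?h' \<in> chirped g"
    using h base assms(3) by (intro chirped.intros) auto
  moreover have "has_dir_deriv (?h t) b (?h' t)" for t
    using has_dir_deriv_mult[OF has_dir_deriv_chirp has_dir_deriv_cnj_partials[OF assms(1) base]]
    by (simp add: mult.assoc)
  ultimately show ?case by (intro bexI[of _ ?h'] allI)
next
  case (linear h c)
  then obtain h' where h': "h' \<in> chirped g" "\<And>t. has_dir_deriv (h t) b (h' t)" by blast
  have "(\<lambda>t y. of_real (y \<bullet> c) * h' t y + of_real (b \<bullet> c) * h t y) \<in> chirped g"
    using h' linear by (intro chirped.add chirped.linear chirped.scale) auto
  then show ?case
    by (rule bexI[rotated]) (intro allI has_dir_deriv_mult[OF has_dir_deriv_inner h'(2)])
next
  case (parameter h)
  then obtain h' where h': "h' \<in> chirped g" "\<And>t. has_dir_deriv (h t) b (h' t)" by blast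
  from chirped.parameter[OF h'(1)] show ?case
    by (rule bexI[rotated]) (intro allI has_dir_deriv_cmult h'(2))
next
  case (scale h a)
  then obtain h' where h': "h' \<in> chirped g" "\<And>t. has_dir_deriv (h t) b (h' t)" by blast
  from chirped.scale[OF h'(1), of a] show ?case
    by (rule bexI[rotated]) (intro allI has_dir_deriv_cmult h'(2))
next
  case (add h1 h2)
  then obtain h1' h2' where h': "h1' \<in> chirped g" "\<And>t. has_dir_deriv (h1 t) b (h1' t)"
    "h2' \<in> chirped g" "\<And>t. has_dir_deriv (h2 t) b (h2' t)" by blast
  from chirped.add[OF h'(1,3)] show ?case
    by (rule bexI[rotated]) (intro allI has_dir_deriv_add h'(2,4))
qed

lemma continuous_on_partials:
  "f \<in> schwartz \<Longrightarrow> set bs \<subseteq> Basis \<Longrightarrow> continuous_on UNIV (partials bs f)"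
  using schwartz_differentiable differentiable_imp_continuous_on by blast

lemma chirped_continuous:
  assumes "g \<in> schwartz" "h \<in> chirped g"
  shows "continuous_on UNIV (h t)"
  using assms(2)
  by induction (auto intro!: continuous_intros continuous_on_chirp continuous_on_partials assms(1))

text \<open>A linear form costs one power of \<open>1 + norm y\<close> and a factor \<open>t\<close>
  at most \<open>T\<close>. The induction therefore runs over all \<open>k\<close> at once and uses
  \<open>Suc k\<close> in the case \<open>linear\<close>.\<close>

lemma chirped_bounded:
  assumes "g \<in> schwartz" "h \<in> chirped g"
  shows "\<exists>C. \<forall>t y. \<bar>t\<bar> \<le> T \<longrightarrow> (1 + norm y) ^ k * norm (h t y) \<le> C"
  using assms(2)
proof (induction arbitrary: k)
  case (base bs)
  from schwartz_bounded[OF assms(1) base]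
  obtain C where "\<And>x. (1 + norm x) ^ k * norm (partials bs g x) \<le> C" by blast
  then show ?case by (auto simp: norm_mult)
next
  case (linear h c)
  then obtain C where C: "\<And>t y. \<bar>t\<bar> \<le> T \<Longrightarrow> (1 + norm y) ^ Suc k * norm (h t y) \<le> C" by meson
  have "(1 + norm y) ^ k * norm (of_real (y \<bullet> c) * h t y) \<le> norm c * C" if t: "\<bar>t\<bar> \<le> T" for t y
  proof -
    have "\<bar>y \<bullet> c\<bar> \<le> norm y * norm c" by (rule Cauchy_Schwarz_ineq2)
    also have "\<dots> \<le> (1 + norm y) * norm c" by (intro mult_right_mono) auto
    finally have "(1 + norm y) ^ k * (\<bar>y \<bullet> c\<bar> * norm (h t y)) \<le>
        (1 + norm y) ^ k * ((1 + norm y) * norm c * norm (h t y))"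
      by (intro mult_left_mono mult_right_mono) auto
    also have "\<dots> = norm c * ((1 + norm y) ^ Suc k * norm (h t y))" by simp
    also have "\<dots> \<le> norm c * C" using C[OF t] by (intro mult_left_mono) auto
    finally show ?thesis by (simp add: norm_mult)
  qed
  then show ?case by blast
next
  case (parameter h)
  then obtain C where C: "\<And>t y. \<bar>t\<bar> \<le> T \<Longrightarrow> (1 + norm y) ^ k * norm (h t y) \<le> C" by meson
  have "(1 + norm y) ^ k * norm (of_real t * h t y) \<le> T * C" if t: "\<bar>t\<bar> \<le> T" for t y
  proof -
    have "\<bar>t\<bar> * ((1 + norm y) ^ k * norm (h t y)) \<le> T * C"
      using C[OF t] t by (intro mult_mono) auto
    then show ?thesis by (simp add: norm_mult mult.left_commute)
  qed
  then show ?case by blast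
next
  case (scale h a)
  then obtain C where C: "\<And>t y. \<bar>t\<bar> \<le> T \<Longrightarrow> (1 + norm y) ^ k * norm (h t y) \<le> C" by meson
  then have "norm a * ((1 + norm y) ^ k * norm (h t y)) \<le> norm a * C" if "\<bar>t\<bar> \<le> T" for t y
    using that by (intro mult_left_mono) auto
  then show ?case by (auto simp: norm_mult mult.left_commute)
next
  case (add h h')
  then obtain C C' where C: "\<And>t y. \<bar>t\<bar> \<le> T \<Longrightarrow> (1 + norm y) ^ k * norm (h t y) \<le> C"
    "\<And>t y. \<bar>t\<bar> \<le> T \<Longrightarrow> (1 + norm y) ^ k * norm (h' t y) \<le> C'" by meson
  have "(1 + norm y) ^ k * norm (h t y + h' t y) \<le> C + C'" if t: "\<bar>t\<bar> \<le> T" for t y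
  proof -
    have "(1 + norm y) ^ k * norm (h t y + h' t y) \<le> (1 + norm y) ^ k * (norm (h t y) + norm (h' t y))"
      by (intro mult_left_mono norm_triangle_ineq) auto
    also have "\<dots> \<le> C + C'" using C[OF t, of y] by (simp add: distrib_left add_mono)
    finally show ?thesis .
  qed
  then show ?case by blast
qed

lemma integrable_wave:
  fixes f :: "'a::euclidean_space \<Rightarrow> complex"
  assumes "integrable lborel f" "f \<in> borel_measurable borel"
  shows "integrable lborel (\<lambda>y. f y * wave \<zeta> y)"
proof (rule Bochner_Integration.integrable_bound[OF assms(1)])
  note [measurable] = assms(2) borel_measurable_continuous_onI[OF continuous_on_wave]
  show "(\<lambda>y. f y * wave \<zeta> y) \<in> borel_measurable lborel" by measurable
qed (simp add: norm_mult)

lemma chirped_measurable: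
  "g \<in> schwartz \<Longrightarrow> h \<in> chirped g \<Longrightarrow> h t \<in> borel_measurable borel"
  by (intro borel_measurable_continuous_onI chirped_continuous)

lemma chirped_integrable:
  assumes "g \<in> schwartz" "h \<in> chirped g"
  shows "integrable lborel (h t)"
proof -
  obtain C where "\<And>y. (1 + norm y) ^ (2 * DIM('a \<times> 'a)) * norm (h t y) \<le> C"
    using chirped_bounded[OF assms, of "\<bar>t\<bar>"] by blast
  then show ?thesis using chirped_measurable[OF assms] by (intro integrable_decay)
qed

lemma chirped_fourier_dir_deriv:
  assumes "g \<in> schwartz" "h \<in> chirped g" "b \<in> Basis"
  shows "\<exists>h'\<in>chirped g. \<forall>t \<zeta>.
    fourier (h' t) \<zeta> = 2 * of_real pi * \<i> * of_real (b \<bullet> \<zeta>) * fourier (h t) \<zeta>"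
proof -
  obtain h' where h': "h' \<in> chirped g" "\<And>t. has_dir_deriv (h t) b (h' t)"
    using chirped_dir_deriv[OF assms] by blast
  have "fourier (h' t) \<zeta> = 2 * of_real pi * \<i> * of_real (b \<bullet> \<zeta>) * fourier (h t) \<zeta>" for t \<zeta>
  proof -
    obtain C where C: "\<And>y. (1 + norm y) ^ (2 * DIM('a \<times> 'a)) * norm (h t y) \<le> C"
      using chirped_bounded[OF assms(1,2), of "\<bar>t\<bar>"] by blast
    obtain C' where C': "\<And>y. (1 + norm y) ^ (2 * DIM('a \<times> 'a)) * norm (h' t y) \<le> C'"
      using chirped_bounded[OF assms(1) h'(1), of "\<bar>t\<bar>"] by blast
    show ?thesis
      by (rule fourier_dir_deriv[where C="max C C'"])
         (use assms h' C C' in \<open>auto intro: chirped_continuous order_trans[OF _ max.cobounded1]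
            order_trans[OF _ max.cobounded2]\<close>)
  qed
  with h'(1) show ?thesis by blast
qed

text \<open>On the Fourier side, \<open>h\<close> minus \<open>1 / (2 * pi)\<^sup>2\<close> times
  its second derivative along \<open>b\<close> acquires the factor
  \<open>1 + (\<zeta> \<bullet> b)\<^sup>2\<close>. Repeating this for each coordinate in
  \<open>B\<close> gives the product.\<close>

lemma chirped_fourier_weight:
  assumes "g \<in> schwartz" "h \<in> chirped g" "finite B" "B \<subseteq> Basis"
  shows "\<exists>h'\<in>chirped g. \<forall>t \<zeta>.
    fourier (h' t) \<zeta> = of_real (\<Prod>b\<in>B. 1 + (\<zeta> \<bullet> b)\<^sup>2) * fourier (h t) \<zeta>"
  using assms(3,4)
proof (induction rule: finite_induct)
  case empty
  then show ?case using assms by auto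
next
  case (insert b B)
  then have b: "b \<in> Basis" by auto
  obtain h0 where h0: "h0 \<in> chirped g"
    "\<And>t \<zeta>. fourier (h0 t) \<zeta> = of_real (\<Prod>b\<in>B. 1 + (\<zeta> \<bullet> b)\<^sup>2) * fourier (h t) \<zeta>"
    using insert by auto
  obtain h1 where h1: "h1 \<in> chirped g"
    "\<And>t \<zeta>. fourier (h1 t) \<zeta> = 2 * of_real pi * \<i> * of_real (b \<bullet> \<zeta>) * fourier (h0 t) \<zeta>"
    using chirped_fourier_dir_deriv[OF assms(1) h0(1) b] by blast
  obtain h2 where h2: "h2 \<in> chirped g"
    "\<And>t \<zeta>. fourier (h2 t) \<zeta> = 2 * of_real pi * \<i> * of_real (b \<bullet> \<zeta>) * fourier (h1 t) \<zeta>"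
    using chirped_fourier_dir_deriv[OF assms(1) h1(1) b] by blast
  \<comment> \<open>Chosen so that \<open>a\<close> times the square of
    \<open>2 * pi * \<i> * (b \<bullet> \<zeta>)\<close> is
    \<open>(\<zeta> \<bullet> b)\<^sup>2\<close>.\<close>
  define a where "a = - 1 / (2 * complex_of_real pi)\<^sup>2"
  have mem: "(\<lambda>t y. h0 t y + a * h2 t y) \<in> chirped g"
    using h0 h2 by (intro chirped.add chirped.scale)
  have "fourier (\<lambda>y. h0 t y + a * h2 t y) \<zeta> = fourier (h0 t) \<zeta> + a * fourier (h2 t) \<zeta>" for t \<zeta>
  proof -
    have "integrable lborel (\<lambda>y. h0 t y * wave \<zeta> y)" "integrable lborel (\<lambda>y. h2 t y * wave \<zeta> y)"
      by (rule integrable_wave[OF chirped_integrable[OF assms(1)] chirped_measurable[OF assms(1)]],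
          rule h0(1) h2(1), rule h0(1) h2(1))+
    then show ?thesis by (simp add: fourier_def distrib_right mult.assoc)
  qed
  also have "fourier (h0 t) \<zeta> + a * fourier (h2 t) \<zeta> = of_real (1 + (\<zeta> \<bullet> b)\<^sup>2) * fourier (h0 t) \<zeta>" for t \<zeta>
    by (simp add: h1 h2 a_def inner_commute power2_eq_square field_simps)
  finally have eq: "fourier (\<lambda>y. h0 t y + a * h2 t y) \<zeta> =
      of_real (\<Prod>b\<in>insert b B. 1 + (\<zeta> \<bullet> b)\<^sup>2) * fourier (h t) \<zeta>" for t \<zeta>
    using insert by (simp add: h0)
  from mem show ?case by (rule bexI[rotated]) (intro allI eq)
qed

text \<open>The transform of \<open>h\<close> times the full weight is the transform of another
  member of the class, hence bounded uniformly for bounded \<open>t\<close>. Dividing by the weight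
  leaves \<open>decay_weight\<close>.\<close>

lemma chirped_fourier_bound:
  assumes "g \<in> schwartz" "h \<in> chirped g"
  shows "\<exists>C. \<forall>t \<zeta>. \<bar>t\<bar> \<le> T \<longrightarrow> norm (fourier (h t) \<zeta>) \<le> C * decay_weight \<zeta>"
proof -
  obtain h' where h': "h' \<in> chirped g"
    "\<And>t \<zeta>. fourier (h' t) \<zeta> = of_real (\<Prod>b\<in>Basis. 1 + (\<zeta> \<bullet> b)\<^sup>2) * fourier (h t) \<zeta>"
    using chirped_fourier_weight[OF assms finite_Basis] by blast
  obtain C where C: "\<And>t y. \<bar>t\<bar> \<le> T \<Longrightarrow> (1 + norm y) ^ (2 * DIM('a \<times> 'a)) * norm (h' t y) \<le> C"
    using chirped_bounded[OF assms(1) h'(1)] by blast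
  define I where "I = (LINT y|lborel. decay_weight (y :: 'a \<times> 'a))"
  have "norm (fourier (h t) \<zeta>) \<le> C * I * decay_weight \<zeta>" if "\<bar>t\<bar> \<le> T" for t \<zeta>
  proof -
    note [measurable] = chirped_measurable[OF assms(1) h'(1)]
      borel_measurable_continuous_onI[OF continuous_on_wave]
    let ?P = "\<Prod>b\<in>Basis. 1 + (\<zeta> \<bullet> b)\<^sup>2"
    have "0 < ?P" by (intro prod_pos) (auto simp: add_pos_nonneg)
    have "norm (fourier (h' t) \<zeta>) \<le> C * I"
      unfolding fourier_def I_def using C[OF that]
      by (intro norm_integral_decay) (auto simp: norm_mult)
    then have "?P * norm (fourier (h t) \<zeta>) \<le> C * I"
      using \<open>0 < ?P\<close> unfolding h'(2) norm_mult norm_of_real by simp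
    then show ?thesis
      using \<open>0 < ?P\<close> by (simp add: decay_weight_def prod_dividef field_simps)
  qed
  then show ?thesis by blast
qed

section \<open>Short-time Fourier transforms of powers of the cardinal sine\<close>

lemma measurable_chirp [measurable (raw)]:
  fixes y :: "'b \<Rightarrow> 'v::euclidean_space \<times> 'v"
  assumes [measurable]: "t \<in> borel_measurable M" "y \<in> borel_measurable M"
  shows "(\<lambda>x. chirp (t x) (y x)) \<in> borel_measurable M"
proof -
  have "(\<lambda>y::'v \<times> 'v. fst y \<bullet> snd y) \<in> borel_measurable borel"
    by (intro borel_measurable_continuous_onI continuous_intros)
  from measurable_compose[OF assms(2) this] show ?thesis
    unfolding chirp_def by measurable
qed

lemma measurable_wave [measurable (raw)]:
  assumes [measurable]: "z \<in> borel_measurable M" "y \<in> borel_measurable M"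
  shows "(\<lambda>x. wave (z x) (y x)) \<in> borel_measurable M"
  unfolding wave_def by measurable

lemma measurable_cnj [measurable]: "cnj \<in> borel_measurable borel"
  by (intro borel_measurable_continuous_onI continuous_intros)

lemma measurable_nsinc [measurable]: "nsinc \<in> borel_measurable borel"
  unfolding nsinc_def by measurable

lemma abs_nsinc_le_1: "\<bar>nsinc t\<bar> \<le> 1"
  using abs_sin_x_le_abs_x[of "pi * t"] by (simp add: nsinc_def abs_mult)

text \<open>For \<open>x \<noteq> 0\<close> an antiderivative is evaluated at the end points, and
  the difference of two conjugate exponentials gives the sine. For \<open>x = 0\<close> the integral
  is the length 1 of the interval.\<close>

lemma nsinc_eq_integral:
  "complex_of_real (nsinc x) =
    (LINT t|lborel. indicator {-1/2..1/2} t *\<^sub>R exp (\<i> * of_real (2 * pi * t * x)))"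
proof (cases "x = 0")
  case True
  then show ?thesis by (simp add: nsinc_def scaleR_conv_of_real)
next
  case False
  define a where "a = 2 * pi * x"
  have a: "a \<noteq> 0" using False by (simp add: a_def)
  define F where "F t = exp (\<i> * of_real (a * t)) / (\<i> * of_real a)" for t :: real
  have "(LINT t|lborel. indicator {-1/2..1/2} t *\<^sub>R exp (\<i> * of_real (a * t))) = F (1/2) - F (-1/2)"
  proof (rule integral_FTC_Icc)
    fix t :: real
    have "((\<lambda>t. \<i> * of_real (a * t)) has_vector_derivative \<i> * of_real a) (at t within {-1/2..1/2})"
      by (auto simp: has_real_derivative_iff_has_vector_derivative[symmetric]
        intro!: derivative_eq_intros has_vector_derivative_of_real)
    from field_vector_diff_chain_within[OF this DERIV_subset[OF DERIV_exp]]
    have "((\<lambda>t. exp (\<i> * of_real (a * t))) has_vector_derivative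
        \<i> * of_real a * exp (\<i> * of_real (a * t))) (at t within {-1/2..1/2})"
      by (simp add: o_def)
    from has_vector_derivative_divide[OF this, of "\<i> * of_real a"]
    show "(F has_vector_derivative exp (\<i> * of_real (a * t))) (at t within {-1/2..1/2})"
      using a by (simp add: F_def[abs_def])
  qed (auto intro!: continuous_intros)
  also have "F (1/2) - F (-1/2) = of_real (sin (a / 2) / (a / 2))"
  proof -
    have "F (1/2) - F (-1/2) = (cis (a / 2) - cis (- (a / 2))) / (\<i> * of_real a)"
      by (simp add: F_def cis_conv_exp diff_divide_distrib)
    also have "cis (a / 2) - cis (- (a / 2)) = \<i> * of_real (2 * sin (a / 2))"
      by (simp add: complex_eq_iff)
    finally show ?thesis using a by simp
  qed
  also have "sin (a / 2) / (a / 2) = nsinc x"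
    using False by (simp add: nsinc_def a_def)
  finally show ?thesis by (simp add: a_def mult_ac)
qed

text \<open>The case \<open>s = 0\<close> is \<open>Theta n\<close>, the case \<open>n = 0\<close> a
  pure chirp; the family joins the target to the functions that are estimated directly.\<close>

definition modulated_Theta :: "nat \<Rightarrow> real \<Rightarrow> 'v::euclidean_space \<times> 'v \<Rightarrow> complex" where
  "modulated_Theta n s y = of_real (nsinc (fst y \<bullet> snd y) ^ n) * chirp s y"

lemma norm_modulated_Theta_le_1: "norm (modulated_Theta n s y) \<le> 1"
  by (simp add: modulated_Theta_def norm_mult norm_power abs_nsinc_le_1 power_le_one)

lemma measurable_modulated_Theta [measurable (raw)]:
  fixes y :: "'b \<Rightarrow> 'v::euclidean_space \<times> 'v"
  assumes [measurable]: "t \<in> borel_measurable M" "y \<in> borel_measurable M"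
  shows "(\<lambda>x. modulated_Theta n (t x) (y x)) \<in> borel_measurable M"
proof -
  have "(\<lambda>y::'v \<times> 'v. fst y \<bullet> snd y) \<in> borel_measurable borel"
    by (intro borel_measurable_continuous_onI continuous_intros)
  from measurable_compose[OF assms(2) this] show ?thesis
    unfolding modulated_Theta_def by measurable
qed

text \<open>One factor \<open>nsinc\<close> is expanded into an average of chirps, and
  \<open>chirp_add\<close> absorbs each of them into the modulation.\<close>

lemma modulated_Theta_Suc:
  "modulated_Theta (Suc n) s y =
    (LINT t|lborel. indicator {-1/2..1/2} t *\<^sub>R modulated_Theta n (s + t) y)"
proof -
  have "modulated_Theta (Suc n) s y = modulated_Theta n s y * of_real (nsinc (fst y \<bullet> snd y))"
    by (simp add: modulated_Theta_def)
  also have "\<dots> = (LINT t|lborel. modulated_Theta n s y *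
      (indicator {-1/2..1/2} t *\<^sub>R exp (\<i> * of_real (2 * pi * t * (fst y \<bullet> snd y)))))"
    unfolding nsinc_eq_integral by (rule integral_mult_right_zero[symmetric])
  also have "\<dots> = (LINT t|lborel. indicator {-1/2..1/2} t *\<^sub>R modulated_Theta n (s + t) y)"
    by (intro Bochner_Integration.integral_cong refl)
       (simp only: modulated_Theta_def chirp_add, simp add: chirp_def mult_ac)
  finally show ?thesis .
qed

lemma schwartz_measurable: "f \<in> schwartz \<Longrightarrow> f \<in> borel_measurable borel"
  using continuous_on_partials[of f "[]"] by (auto simp: partials_def intro: borel_measurable_continuous_onI)

lemma schwartz_integrable:
  assumes "f \<in> schwartz"
  shows "integrable lborel f"
proof -
  obtain C where "\<And>x. (1 + norm x) ^ (2 * DIM('a)) * norm (partials [] f x) \<le> C"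
    using schwartz_bounded[OF assms, of "[]"] by auto
  then show ?thesis
    using schwartz_measurable[OF assms] by (intro integrable_decay) (auto simp: partials_def)
qed

text \<open>Integrability is not assumed: otherwise the Bochner integral is 0 and the bound is
  trivial.\<close>

lemma ennreal_norm_integral_le:
  fixes f :: "'a \<Rightarrow> complex"
  shows "ennreal (norm (integral\<^sup>L M f)) \<le> (\<integral>\<^sup>+ x. ennreal (norm (f x)) \<partial>M)"
  by (cases "integrable M f") (auto simp: integral_norm_bound_ennreal not_integrable_integral_eq)

lemma measurable_stft_modulated_Theta [measurable (raw)]:
  assumes "g \<in> schwartz" and [measurable]: "s \<in> borel_measurable M" "\<zeta> \<in> borel_measurable M"
  shows "(\<lambda>x. stft g (regular_distr (modulated_Theta n (s x))) z (\<zeta> x)) \<in> borel_measurable M"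
proof -
  note [measurable] = schwartz_measurable[OF assms(1)]
  show ?thesis
    unfolding stft_regular_distr wave_def[symmetric] by measurable
qed

text \<open>Fubini applied to the average over \<open>t\<close>. Since
  \<open>modulated_Theta\<close> and the wave have norm at most 1, the integrand is dominated by the
  indicator times the norm of the translated window.\<close>

lemma stft_modulated_Theta_Suc:
  fixes g :: "'v::euclidean_space \<times> 'v \<Rightarrow> complex"
  assumes "g \<in> schwartz"
  shows "stft g (regular_distr (modulated_Theta (Suc n) s)) z \<zeta> =
    (LINT t|lborel. indicator {-1/2..1/2} t *\<^sub>R stft g (regular_distr (modulated_Theta n (s + t))) z \<zeta>)"
proof -
  note [measurable] = schwartz_measurable[OF assms]
  define f where "f t y = indicator {-1/2..1/2} t *\<^sub>R (modulated_Theta n (s + t) y * cnj (g (y - z)) * wave \<zeta> y)"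
    for t :: real and y :: "'v \<times> 'v"
  have [measurable]: "case_prod f \<in> borel_measurable (lborel \<Otimes>\<^sub>M lborel)"
    unfolding f_def by measurable
  have [measurable]: "f t \<in> borel_measurable borel" for t
    unfolding f_def by measurable
  have g: "integrable lborel (\<lambda>y. norm (g (y - z)))"
    using integrable_lborel_translate[of g "-z"] schwartz_integrable[OF assms] by simp
  have le: "norm (f t y) \<le> indicator {-1/2..1/2} t * norm (g (y - z))" for t y
    by (auto simp: f_def norm_mult mult_left_le_one_le norm_modulated_Theta_le_1 split: split_indicator)
  have int: "integrable lborel (f t)" for t
    by (rule Bochner_Integration.integrable_bound[OF integrable_mult_right[OF g, of "indicator {-1/2..1/2} t"]])
       (use le in \<open>auto simp: abs_mult\<close>)
  have "integrable (lborel \<Otimes>\<^sub>M lborel) (case_prod f)"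
  proof (rule lborel_pair.Fubini_integrable)
    have "integrable lborel (\<lambda>t::real. indicator {-1/2..1/2} t * (LINT y|lborel. norm (g (y - z))))"
      by simp
    then show "integrable lborel (\<lambda>t. LINT y|lborel. norm (case (t, y) of (t, y) \<Rightarrow> f t y))"
    proof (rule Bochner_Integration.integrable_bound)
      have "norm (LINT y|lborel. norm (f t y)) \<le> norm (indicator {-1/2..1/2} t * (LINT y|lborel. norm (g (y - z))))" for t
      proof -
        have "(LINT y|lborel. norm (f t y)) \<le> (LINT y|lborel. indicator {-1/2..1/2} t * norm (g (y - z)))"
          using int g le by (intro integral_mono) auto
        then show ?thesis by (simp add: abs_mult)
      qed
      then show "AE t in lborel. norm (LINT y|lborel. norm (case (t, y) of (t, y) \<Rightarrow> f t y)) \<le>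
          norm (indicator {-1/2..1/2} t * (LINT y|lborel. norm (g (y - z))))" by simp
    qed measurable
  qed (use int in auto)
  from lborel_pair.Fubini_integral[OF this]
  have "(LINT y|lborel. LINT t|lborel. f t y) = (LINT t|lborel. LINT y|lborel. f t y)" .
  moreover have "(LINT t|lborel. f t y) = modulated_Theta (Suc n) s y * cnj (g (y - z)) * wave \<zeta> y" for y
    by (simp add: f_def modulated_Theta_Suc scaleR_conv_of_real mult.assoc[symmetric])
  ultimately show ?thesis
    unfolding stft_regular_distr wave_def[symmetric] by (simp add: f_def)
qed

text \<open>After substituting \<open>z + y\<close> for \<open>y\<close>, the chirp phase splits
  into a constant, the phase at \<open>y\<close>, and the cross term
  \<open>s * (y \<bullet> prod.swap z)\<close>. The constant has modulus 1, and the cross term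
  shifts the frequency.\<close>

lemma norm_stft_modulated_Theta_0:
  assumes "g \<in> schwartz"
  shows "norm (stft g (regular_distr (modulated_Theta 0 s)) z \<zeta>) =
    norm (fourier (\<lambda>y. chirp s y * cnj (g y)) (- s *\<^sub>R prod.swap z + \<zeta>))"
proof -
  note [measurable] = schwartz_measurable[OF assms]
  have *: "chirp s (z + y) * cnj (g y) * wave \<zeta> (z + y) =
      chirp s z * wave \<zeta> z * (chirp s y * cnj (g y) * wave (- s *\<^sub>R prod.swap z + \<zeta>) y)" for y
    by (simp add: chirp_def wave_def exp_add[symmetric] mult_ac)
       (simp add: inner_prod_def inner_commute algebra_simps exp_add[symmetric])
  have "stft g (regular_distr (modulated_Theta 0 s)) z \<zeta> =
      (LINT y|lborel. chirp s y * cnj (g (y - z)) * wave \<zeta> y)"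
    by (simp add: stft_regular_distr wave_def modulated_Theta_def)
  also have "\<dots> = (LINT y|lborel. chirp s (z + y) * cnj (g y) * wave \<zeta> (z + y))"
    using integral_lborel_translate[of "\<lambda>y. chirp s y * cnj (g (y - z)) * wave \<zeta> y" z] by simp
  also have "\<dots> = chirp s z * wave \<zeta> z * fourier (\<lambda>y. chirp s y * cnj (g y)) (- s *\<^sub>R prod.swap z + \<zeta>)"
    unfolding * fourier_def by simp
  finally show ?thesis by (simp add: norm_mult)
qed

text \<open>The modulation parameter \<open>s\<close> makes the induction on \<open>n\<close> possible: passing from \<open>n\<close> to
  \<open>Suc n\<close> averages over \<open>s + t\<close> with \<open>\<bar>t\<bar> \<le> 1/2\<close>.\<close>

lemma stft_modulated_Theta_bound:
  fixes g :: "'v::euclidean_space \<times> 'v \<Rightarrow> complex"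
  assumes g: "g \<in> schwartz"
  shows "\<exists>C<\<infinity>. \<forall>n s z. \<bar>s\<bar> + n / 2 \<le> T \<longrightarrow>
    (\<integral>\<^sup>+ \<zeta>. ennreal (norm (stft g (regular_distr (modulated_Theta n s)) z \<zeta>)) \<partial>lborel) \<le> C"
proof -
  let ?h = "\<lambda>t y. chirp t y * cnj (g y)"
  have "?h \<in> chirped g"
    using chirped.base[of "[]" g] by (simp add: partials_def)
  from chirped_fourier_bound[OF g this] obtain C
    where C: "\<And>t \<zeta>. \<bar>t\<bar> \<le> T \<Longrightarrow> norm (fourier (?h t) \<zeta>) \<le> C * decay_weight \<zeta>" by blast
  note [measurable] = schwartz_measurable[OF g] measurable_stft_modulated_Theta[OF g]
  have [measurable]: "fourier (?h t) \<in> borel_measurable borel" for t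
    unfolding fourier_def by measurable
  define K where "K = (\<integral>\<^sup>+ \<zeta>. ennreal (C * decay_weight (\<zeta> :: 'v \<times> 'v)) \<partial>lborel)"
  have "integrable lborel (\<lambda>\<zeta> :: 'v \<times> 'v. C * decay_weight \<zeta>)"
    by (intro integrable_mult_right integrable_decay_weight)
  then have "(\<integral>\<^sup>+ \<zeta>. ennreal (norm (C * decay_weight (\<zeta> :: 'v \<times> 'v))) \<partial>lborel) < \<infinity>"
    unfolding integrable_iff_bounded by blast
  \<comment> \<open>The sign of \<open>C\<close> is not known, but \<open>ennreal\<close> sends
    negative numbers to 0, so passing to absolute values only increases the integral.\<close>
  moreover have "K \<le> (\<integral>\<^sup>+ \<zeta>. ennreal (norm (C * decay_weight (\<zeta> :: 'v \<times> 'v))) \<partial>lborel)"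
    unfolding K_def by (intro nn_integral_mono ennreal_leI) simp
  ultimately have "K < \<infinity>" by (rule order_le_less_trans[rotated])
  moreover have "(\<integral>\<^sup>+ \<zeta>. ennreal (norm (stft g (regular_distr (modulated_Theta n s)) z \<zeta>)) \<partial>lborel) \<le> K"
    if "\<bar>s\<bar> + n / 2 \<le> T" for n s z
    using that
  proof (induction n arbitrary: s)
    case 0
    then have s: "\<bar>s\<bar> \<le> T" by simp
    \<comment> \<open>The frequency shift by \<open>- s *\<^sub>R prod.swap z\<close> leaves the
      integral unchanged; here the dependence on \<open>z\<close> disappears.\<close>
    have "(\<integral>\<^sup>+ \<zeta>. ennreal (norm (stft g (regular_distr (modulated_Theta 0 s)) z \<zeta>)) \<partial>lborel) =
        (\<integral>\<^sup>+ \<zeta>. ennreal (norm (fourier (?h s) \<zeta>)) \<partial>lborel)"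
      unfolding norm_stft_modulated_Theta_0[OF g]
      by (rule nn_integral_lborel_translate) measurable
    also have "\<dots> \<le> K"
      unfolding K_def using C[OF s] by (intro nn_integral_mono ennreal_leI)
    finally show ?case .
  next
    case (Suc n)
    let ?I = "{-1/2..1/2::real}"
    let ?V = "\<lambda>t \<zeta>. ennreal (norm (stft g (regular_distr (modulated_Theta n (s + t))) z \<zeta>))"
    have "(\<integral>\<^sup>+ \<zeta>. ennreal (norm (stft g (regular_distr (modulated_Theta (Suc n) s)) z \<zeta>)) \<partial>lborel) \<le>
        (\<integral>\<^sup>+ \<zeta>. (\<integral>\<^sup>+ t. indicator ?I t * ?V t \<zeta> \<partial>lborel) \<partial>lborel)"
    proof (intro nn_integral_mono)
      fix \<zeta>
      show "ennreal (norm (stft g (regular_distr (modulated_Theta (Suc n) s)) z \<zeta>)) \<le>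
          (\<integral>\<^sup>+ t. indicator ?I t * ?V t \<zeta> \<partial>lborel)"
        unfolding stft_modulated_Theta_Suc[OF g]
        by (rule order_trans[OF ennreal_norm_integral_le])
           (auto intro!: nn_integral_mono split: split_indicator)
    qed
    also have "\<dots> = (\<integral>\<^sup>+ t. (\<integral>\<^sup>+ \<zeta>. indicator ?I t * ?V t \<zeta> \<partial>lborel) \<partial>lborel)"
      by (rule lborel_pair.Fubini') measurable
    also have "\<dots> = (\<integral>\<^sup>+ t. indicator ?I t * (\<integral>\<^sup>+ \<zeta>. ?V t \<zeta> \<partial>lborel) \<partial>lborel)"
      by (intro nn_integral_cong nn_integral_cmult) measurable
    also have "\<dots> \<le> (\<integral>\<^sup>+ t. K * indicator ?I t \<partial>lborel)"
    proof (intro nn_integral_mono)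
      fix t
      show "indicator ?I t * (\<integral>\<^sup>+ \<zeta>. ?V t \<zeta> \<partial>lborel) \<le> K * indicator ?I t"
      proof (cases "t \<in> ?I")
        case True
        \<comment> \<open>The sum \<open>\<bar>s\<bar> + n / 2\<close> is the invariant: replacing
          \<open>s\<close> by \<open>s + t\<close> adds at most the 1/2 that is released by passing
          from \<open>Suc n\<close> to \<open>n\<close>.\<close>
        then have "\<bar>t\<bar> \<le> 1 / 2" by auto
        then have "\<bar>s + t\<bar> + n / 2 \<le> T"
          using Suc.prems abs_triangle_ineq[of s t] by (simp add: add_divide_distrib)
        then show ?thesis using Suc.IH[of "s + t"] True by simp
      qed simp
    qed
    \<comment> \<open>The interval has length 1, so averaging does not enlarge the constant.\<close>
    also have "\<dots> = K" by (simp add: nn_integral_cmult_indicator)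
    finally show ?case .
  qed
  ultimately show ?thesis by blast
qed

section \<open>Bounded measurable functions as tempered distributions\<close>

lemma schwartz_seminorm_ge:
  assumes "f \<in> schwartz"
  shows "(1 + norm x) ^ N * norm (f x) \<le> schwartz_seminorm N f"
proof -
  let ?S = "\<lambda>bs. SUP x. (1 + norm x) ^ N * norm (partials bs f x)"
  have bdd: "bdd_above (range (\<lambda>x. (1 + norm x) ^ N * norm (partials bs f x)))"
    if "set bs \<subseteq> Basis" for bs
    by (rule schwartz_bounded[OF assms that, of N]) (rule bdd_aboveI2)
  have "(1 + norm x) ^ N * norm (f x) \<le> ?S []"
    using cSUP_upper[OF _ bdd[of "[]"], of x] by (simp add: partials_def)
  also have "\<dots> = (\<Sum>bs\<in>{[]}. ?S bs)" by simp
  also have "\<dots> \<le> schwartz_seminorm N f"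
    unfolding schwartz_seminorm_def
  proof (rule sum_mono2)
    \<comment> \<open>Finiteness matters: a sum over an infinite set would be 0 by
      convention.\<close>
    show "finite {bs :: 'a list. set bs \<subseteq> Basis \<and> length bs \<le> N}"
      by (intro finite_lists_length_le finite_Basis)
    fix bs :: "'a list" assume "bs \<in> {bs. set bs \<subseteq> Basis \<and> length bs \<le> N} - {[]}"
    then show "0 \<le> ?S bs"
      by (intro cSUP_upper2[where x=0] bdd) auto
  qed auto
  finally show ?thesis .
qed

text \<open>Multiplication by \<open>F\<close> does not increase the norm, so the decay of the test
  function, measured by the seminorm of order \<open>2 * DIM('a)\<close>, gives both integrability
  and continuity.\<close>

lemma
  fixes F :: "'a::euclidean_space \<Rightarrow> complex"
  assumes [measurable]: "F \<in> borel_measurable borel" and F: "\<And>y. norm (F y) \<le> 1"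
  shows integrable_bounded_mult_schwartz: "\<phi> \<in> schwartz \<Longrightarrow> integrable lborel (\<lambda>y. F y * \<phi> y)"
    and tempered_regular_distr: "regular_distr F \<in> tempered"
proof -
  have meas: "(\<lambda>y. F y * \<phi> y) \<in> borel_measurable borel" if "\<phi> \<in> schwartz" for \<phi>
    using schwartz_measurable[OF that] by measurable
  have bound: "(1 + norm y) ^ (2 * DIM('a)) * norm (F y * \<phi> y) \<le> schwartz_seminorm (2 * DIM('a)) \<phi>"
    if "\<phi> \<in> schwartz" for \<phi> y
  proof -
    have "norm (F y * \<phi> y) \<le> norm (\<phi> y)"
      using F[of y] by (simp add: norm_mult mult_left_le_one_le)
    then have "(1 + norm y) ^ (2 * DIM('a)) * norm (F y * \<phi> y) \<le> (1 + norm y) ^ (2 * DIM('a)) * norm (\<phi> y)"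
      by (intro mult_left_mono) auto
    with schwartz_seminorm_ge[OF that] show ?thesis by (meson order_trans)
  qed
  show int: "integrable lborel (\<lambda>y. F y * \<phi> y)" if "\<phi> \<in> schwartz" for \<phi>
    using integrable_decay[OF meas bound] that by blast
  have "norm (regular_distr F \<phi>) \<le> (LINT x|lborel. decay_weight (x::'a)) * schwartz_seminorm (2 * DIM('a)) \<phi>"
    if "\<phi> \<in> schwartz" for \<phi>
    unfolding regular_distr_def
    by (rule order_trans[OF norm_integral_decay[OF meas[OF that] bound[OF that]]]) simp
  then show "regular_distr F \<in> tempered"
    using int by (auto simp: tempered_def regular_distr_def distrib_left mult.left_commute)
qed

theorem proposition4p2:
  fixes n :: nat and g :: "(real ^ 'd) \<times> (real ^ 'd) \<Rightarrow> complex"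
  assumes "n \<ge> 1" and "g \<in> schwartz" and "g \<noteq> (\<lambda>_. 0)"
  shows "Theta n \<in> wiener_amalgam_fun g 1 \<infinity>"
proof -
  have Theta: "(Theta n :: (real ^ 'd) \<times> (real ^ 'd) \<Rightarrow> complex) = modulated_Theta n 0"
    by (simp add: Theta_def modulated_Theta_def chirp_def fun_eq_iff)
  have meas: "modulated_Theta n 0 \<in> borel_measurable borel"
    by measurable
  obtain C where "C < \<infinity>" and "\<And>z. (\<integral>\<^sup>+ \<zeta>. ennreal (norm (stft g (regular_distr (Theta n)) z \<zeta>)) \<partial>lborel) \<le> C"
    \<comment> \<open>With \<open>s = 0\<close> the condition
      \<open>\<bar>s\<bar> + n / 2 \<le> T\<close> holds for \<open>T = n / 2\<close>.\<close>
    using stft_modulated_Theta_bound[OF assms(2), of "n / 2"] unfolding Theta by auto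
  then have "amalgam_norm g 1 \<infinity> (regular_distr (Theta n)) < \<infinity>"
    unfolding amalgam_norm_1_infinity by (meson SUP_least order_le_less_trans)
  then show ?thesis
    unfolding wiener_amalgam_fun_def wiener_amalgam_def Theta
    using integrable_bounded_mult_schwartz[OF meas norm_modulated_Theta_le_1]
      tempered_regular_distr[OF meas norm_modulated_Theta_le_1] by auto
qed

end
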